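(* For every $n\ge 1$, the restrictions $\Phi_n=\Phi|_{\mathcal A_n}$ and $\Psi_{n-1}=\Psi|_{F_{n-1}}$ are mutually inverse bijections $$\Phi_n:\mathcal A_n\longleftrightarrow F_{n-1}:\Psi_{n-1}$$ between the set $\mathcal A_n$ of admissible trees with $n$ leaves and the set $F_{n-1}$ of $F$-paths with $n-1$ steps.
   Context: Trees. Consider planar binary trees with unlabeled leaves $*$ and internal vertices labeled $\bullet$ or $\circ$; $\alpha(L,R)$ denotes the tree with root label $\alpha$, left subtree $L$, right subtree $R$. A tree is admissible if it contains no subtree of the form $\bullet(\circ(\cdot,\cdot),\cdot)$, $\circ(\circ(\cdot,\cdot),\cdot)$ or $\bullet(\bullet(\bullet(\cdot,\cdot),\cdot),\cdot)$ (dots are arbitrary trees). $\mathcal A_n$ is the set of admissible trees with $n$ leaves; $\mathcal A_1=\{*\}$. Direct sum. The rightmost leaf of a tree is reached from the root by always following the right edge. For admissible $T,S$, $T\oplus S$ is obtained from $T$ by replacing its rightmost leaf by $\circ( *,S)$; this is again admissible and $\oplus$ is associative. An admissible tree is indecomposable if it is not of the form $U\oplus V$. Every admissible tree $T$ has a unique decomposition $T=T_1\oplus\cdots\oplus T_r$ into indecomposable admissible trees; the block number is $\mathrm{bl}(T)=r$. Paths. $F_m$ is the set of lattice paths $Q=((0,0),(x_1,y_1),\dots,(x_m,y_m))$ whose steps lie in $F=\{(a,b)\in\mathbb Z^2\mid a\ge1,\ b\le1\}\cup\{(0,1)\}$ and such that $x_i\le y_i$ for all $i$; $F_0=\{\varnothing\}$.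 Paths are written as words of steps; the height is $\mathrm{ht}(Q)=y_m-x_m$ ($\mathrm{ht}(\varnothing)=0$). Every non-leaf admissible tree has exactly one of the forms $\circ( *,R)$, $\bullet( *,R)$, $\bullet(\bullet( *,U),R)$, $\circ(\bullet( *,U),R)$, $\circ(\bullet(\bullet( *,U_1),U_2),R)$ with $R,U,U_1,U_2$ admissible. Map $\Phi:\bigsqcup_{n\ge1}\mathcal A_n\to\bigsqcup_{m\ge0}F_m$, defined recursively by $\Phi( * )=\varnothing$ and $$\begin{aligned} \Phi(\circ( *,R))&=\Phi(R)\,(0,1),\\ \Phi(\bullet( *,R))&=\Phi(R)\,(1,1),\\ \Phi(\bullet(\bullet( *,U),R))&=\Phi(U\oplus R)\,(\mathrm{bl}(U)+1,\,1),\\ \Phi(\circ(\bullet( *,U),R))&=\Phi(U\oplus R)\,(1,\,1-\mathrm{bl}(U)),\\ \Phi(\circ(\bullet(\bullet( *,U_1),U_2),R))&=\Phi(U_1\oplus U_2\oplus R)\,(\mathrm{bl}(U_1)+1,\,1-\mathrm{bl}(U_2)). \end{aligned}$$ Map $\Psi:\bigsqcup_{m\ge0}F_m\to\bigsqcup_{n\ge1}\mathcal A_n$, defined recursively by $\Psi(\varnothing)=*$ and, for $Q=\widehat Q\,(a,b)$ with $\widehat T=\Psi(\widehat Q)=T_1\oplus\cdots\oplus T_r$ (decomposition into indecomposables, $r=\mathrm{bl}(\widehat T)=\mathrm{ht}(\widehat Q)+1$): - if $(a,b)=(0,1)$: $\Psi(Q)=\circ( *,\widehat T)$; - if $(a,b)=(1,1)$: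 $\Psi(Q)=\bullet( *,\widehat T)$; - if $a\ge2$, $b=1$: $\Psi(Q)=\bullet(\bullet( *,U),R)$ with $U=T_1\oplus\cdots\oplus T_{a-1}$, $R=T_a\oplus\cdots\oplus T_r$; - if $a=1$, $b\le0$: $\Psi(Q)=\circ(\bullet( *,U),R)$ with $U=T_1\oplus\cdots\oplus T_{1-b}$, $R=T_{2-b}\oplus\cdots\oplus T_r$; - if $a\ge2$, $b\le0$: $\Psi(Q)=\circ(\bullet(\bullet( *,U_1),U_2),R)$ with $U_1=T_1\oplus\cdots\oplus T_{a-1}$, $U_2=T_a\oplus\cdots\oplus T_{a-b}$, $R=T_{a-b+1}\oplus\cdots\oplus T_r$. *)

theory Defs
  imports "HOL-Library.Tree"
begin

section \<open>Admissible trees\<close>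

datatype label = Bullet | Circ

abbreviation bul :: "label tree \<Rightarrow> label tree \<Rightarrow> label tree" where
  "bul L R \<equiv> Node L Bullet R"

abbreviation cir :: "label tree \<Rightarrow> label tree \<Rightarrow> label tree" where
  "cir L R \<equiv> Node L Circ R"

definition admissible :: "label tree \<Rightarrow> bool" where
  "admissible T \<longleftrightarrow> (\<forall>S \<in> subtrees T.
      (\<nexists>X Y Z. S = bul (cir X Y) Z) \<and>
      (\<nexists>X Y Z. S = cir (cir X Y) Z) \<and>
      (\<nexists>X Y Z W. S = bul (bul (bul X Y) Z) W))"

text \<open>The library function \<^const>\<open>size1\<close> counts leaves.\<close>

definition adm_trees :: "nat \<Rightarrow> label tree set" where
  "adm_trees n = {T. admissible T \<and> size1 T = n}"


section \<open>Direct sum and block decomposition\<close>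

fun dsum :: "label tree \<Rightarrow> label tree \<Rightarrow> label tree" (infixr "\<oplus>" 65) where
  "Leaf \<oplus> S = cir Leaf S"
| "Node L c R \<oplus> S = Node L c (R \<oplus> S)"

definition indecomposable :: "label tree \<Rightarrow> bool" where
  "indecomposable T \<longleftrightarrow> admissible T \<and>
     (\<nexists>U V. admissible U \<and> admissible V \<and> T = U \<oplus> V)"

text \<open>The direct sum has no neutral element, so the empty sum is left unspecified.\<close>

fun dsum_list :: "label tree list \<Rightarrow> label tree" where
  "dsum_list [T] = T"
| "dsum_list (T # T' # Ts) = T \<oplus> dsum_list (T' # Ts)"

definition blocks :: "label tree \<Rightarrow> label tree list" where
  "blocks T = (THE Ts. Ts \<noteq> [] \<and> (\<forall>B \<in> set Ts. indecomposable B) \<and> dsum_list Ts = T)"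

definition bl :: "label tree \<Rightarrow> nat" where
  "bl T = length (blocks T)"


section \<open>Lattice paths\<close>

text \<open>A path starting at the origin is represented by the word of its steps; the point reached
  after \<open>i\<close> steps is the sum of the first \<open>i\<close> letters.\<close>

type_synonym path = "(int \<times> int) list"

definition F_steps :: "(int \<times> int) set" where
  "F_steps = {(a, b). a \<ge> 1 \<and> b \<le> 1} \<union> {(0, 1)}"

definition xpos :: "path \<Rightarrow> nat \<Rightarrow> int" where
  "xpos Q i = sum_list (map fst (take i Q))"

definition ypos :: "path \<Rightarrow> nat \<Rightarrow> int" where
  "ypos Q i = sum_list (map snd (take i Q))"

definition F_paths :: "nat \<Rightarrow> path set" where
  "F_paths m = {Q. length Q = m \<and> set Q \<subseteq> F_steps \<and> (\<forall>i\<le>m. xpos Q i \<le> ypos Q i)}"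


section \<open>The two maps\<close>

lemma size_dsum [simp]: "size (T \<oplus> S) = size T + size S + 1"
  by (induction T) auto

text \<open>The five forms cover every non-leaf admissible tree; on the remaining trees \<open>\<Phi>\<close> is
  unspecified.\<close>

function Phi :: "label tree \<Rightarrow> path" where
  "Phi Leaf = []"
| "Phi (cir Leaf R) = Phi R @ [(0, 1)]"
| "Phi (bul Leaf R) = Phi R @ [(1, 1)]"
| "Phi (bul (bul Leaf U) R) = Phi (U \<oplus> R) @ [(int (bl U) + 1, 1)]"
| "Phi (cir (bul Leaf U) R) = Phi (U \<oplus> R) @ [(1, 1 - int (bl U))]"
| "Phi (cir (bul (bul Leaf U1) U2) R) =
     Phi (U1 \<oplus> U2 \<oplus> R) @ [(int (bl U1) + 1, 1 - int (bl U2))]"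
| "Phi (bul (cir X Y) Z) = undefined"
| "Phi (cir (cir X Y) Z) = undefined"
| "Phi (bul (bul (Node X c Y) Z) W) = undefined"
| "Phi (cir (bul (cir X Y) Z) W) = undefined"
| "Phi (cir (bul (bul (Node V c X) Y) Z) W) = undefined"
  by pat_completeness auto
termination
  by (relation "measure size") auto

text \<open>\<open>psi_step T (a, b)\<close> is the tree \<open>\<Psi>(Q (a, b))\<close> built from \<open>T = \<Psi>(Q)\<close>. The blocks
  \<open>T\<^sub>1, \<dots>, T\<^sub>r\<close> of \<open>T\<close> are cut into consecutive segments: \<open>take k\<close> yields
  \<open>T\<^sub>1, \<dots>, T\<^sub>k\<close> and \<open>drop k\<close> yields the remaining ones. For an admissible
  path all segments used are nonempty. The final branch is for pairs that are not steps.\<close>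

definition psi_step :: "label tree \<Rightarrow> int \<times> int \<Rightarrow> label tree" where
  "psi_step T s = (let (a, b) = s; Ts = blocks T in
     if (a, b) = (0, 1) then cir Leaf T
     else if (a, b) = (1, 1) then bul Leaf T
     else if a \<ge> 2 \<and> b = 1 then
       bul (bul Leaf (dsum_list (take (nat (a - 1)) Ts)))
           (dsum_list (drop (nat (a - 1)) Ts))
     else if a = 1 \<and> b \<le> 0 then
       cir (bul Leaf (dsum_list (take (nat (1 - b)) Ts)))
           (dsum_list (drop (nat (1 - b)) Ts))
     else if a \<ge> 2 \<and> b \<le> 0 then
       cir (bul (bul Leaf (dsum_list (take (nat (a - 1)) Ts)))
                (dsum_list (drop (nat (a - 1)) (take (nat (a - b)) Ts))))
           (dsum_list (drop (nat (a - b)) Ts))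
     else undefined)"

function Psi :: "path \<Rightarrow> label tree" where
  "Psi [] = Leaf"
| "Psi (Q @ [s]) = psi_step (Psi Q) s"
proof -
  fix P and x :: path
  assume "x = [] \<Longrightarrow> P" and "\<And>Q s. x = Q @ [s] \<Longrightarrow> P"
  then show P by (cases x rule: rev_exhaust)
qed auto
termination
  by (relation "measure length") auto

end

(* Along the right spine of a tree, T \<oplus> S inserts a separator node "Circ with left subtree Leaf"
   between the spines of T and S.  Hence the indecomposable blocks of a tree are obtained by cutting
   its right spine at these separators, which gives existence and uniqueness of the decomposition and
   shows that concatenating block lists corresponds to \<oplus>.  The block number of T is one more than
   the height of Phi T; this is exactly what guarantees that the subtrees which Psi cuts out are
   sums of nonempty segments of blocks, so each case of Psi inverts the matching case of Phi. *)

theory Submission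
  imports Defs
begin

section \<open>Admissibility\<close>

lemma admissible_Leaf [simp]: "admissible Leaf"
  by (simp add: admissible_def)

text \<open>The first two forbidden patterns differ only in the root label, so jointly they forbid a
  \<open>Circ\<close> node as left child of any node; only the third depends on
  \<open>c\<close>.\<close>

lemma admissible_Node:
  "admissible (Node L c R) \<longleftrightarrow> admissible L \<and> admissible R \<and> (\<nexists>X Y. L = cir X Y) \<and>
     (c = Bullet \<longrightarrow> (\<nexists>X Y Z. L = bul (bul X Y) Z))"
  by (cases c) (auto simp: admissible_def ball_Un)

text \<open>All forbidden patterns constrain left children; \<open>\<oplus>\<close> only extends the
  right spine, and its new node has left child \<open>Leaf\<close>.\<close>

lemma admissible_dsum [simp]: "admissible (T \<oplus> S) \<longleftrightarrow> admissible T \<and> admissible S"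
  by (induction T) (auto simp: admissible_Node)

lemma dsum_assoc: "(T \<oplus> S) \<oplus> R = T \<oplus> (S \<oplus> R)"
  by (induction T) auto

section \<open>Block decomposition\<close>

text \<open>Computes, for arbitrary trees, what \<open>blocks\<close> only describes by
  \<open>THE\<close>. At a separator a fresh block \<open>Leaf\<close> is opened, the leaf that the
  separator had replaced; any other spine node is put on top of the first block.\<close>

fun spine_blocks :: "label tree \<Rightarrow> label tree list" where
  "spine_blocks Leaf = [Leaf]"
| "spine_blocks (Node L c R) =
     (if L = Leaf \<and> c = Circ then Leaf # spine_blocks R
      else Node L c (hd (spine_blocks R)) # tl (spine_blocks R))"

lemma spine_blocks_nonempty [simp]: "spine_blocks T \<noteq> []"
  by (cases T) auto

lemma spine_blocks_dsum: "spine_blocks (T \<oplus> S) = spine_blocks T @ spine_blocks S"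
  by (induction T) auto

lemma dsum_list_Cons: "Ts \<noteq> [] \<Longrightarrow> dsum_list (T # Ts) = T \<oplus> dsum_list Ts"
  by (cases Ts) auto

lemma dsum_list_append:
  "Ss \<noteq> [] \<Longrightarrow> Ts \<noteq> [] \<Longrightarrow> dsum_list (Ss @ Ts) = dsum_list Ss \<oplus> dsum_list Ts"
  by (induction Ss rule: induct_list012) (auto simp: dsum_list_Cons dsum_assoc)

lemma dsum_list_Node_Cons:
  "dsum_list (Node L c T # Ts) = Node L c (dsum_list (T # Ts))"
  by (cases Ts) auto

lemma dsum_list_spine_blocks: "dsum_list (spine_blocks T) = T"
proof (induction T)
  case (Node L c R)
  then show ?case
    by (auto simp: dsum_list_Cons dsum_list_Node_Cons)
qed auto

lemma set_spine_blocks_NodeE: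
  assumes "B \<in> set (spine_blocks (Node L c R))"
  obtains "B = Leaf" | "B \<in> set (spine_blocks R)"
    | B' where "B' \<in> set (spine_blocks R)" "B = Node L c B'" "\<not> (L = Leaf \<and> c = Circ)"
  using assms by (cases "spine_blocks R") (auto split: if_splits)

lemma admissible_spine_blocks:
  "admissible T \<Longrightarrow> B \<in> set (spine_blocks T) \<Longrightarrow> admissible B"
proof (induction T arbitrary: B)
  case (Node L c R)
  from Node.prems(2) show ?case
  proof (cases rule: set_spine_blocks_NodeE)
    case 2
    with Node.IH(2) Node.prems(1) show ?thesis unfolding admissible_Node by blast
  next
    case (3 B')
    with Node.IH(2) Node.prems(1) show ?thesis by (simp add: admissible_Node)
  qed simp
qed simp

text \<open>A block starts as \<open>Leaf\<close> and only non-separators are put on top of it, so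
  cutting it again finds nothing to cut.\<close>

lemma spine_blocks_singleton:
  "B \<in> set (spine_blocks T) \<Longrightarrow> spine_blocks B = [B]"
proof (induction T arbitrary: B)
  case (Node L c R)
  from Node.prems show ?case
  proof (cases rule: set_spine_blocks_NodeE)
    case 2
    with Node.IH(2) show ?thesis by blast
  next
    case (3 B')
    from Node.IH(2)[OF 3(1)] 3(2,3) show ?thesis by auto
  qed simp
qed simp

text \<open>A second block would split off the first one as a summand; conversely, a sum has at
  least two blocks, since each summand contributes one.\<close>

lemma indecomposable_iff:
  "indecomposable T \<longleftrightarrow> admissible T \<and> spine_blocks T = [T]"
proof
  assume ind: "indecomposable T"
  then have adm: "admissible T" by (simp add: indecomposable_def)
  obtain B Bs where BBs: "spine_blocks T = B # Bs" by (cases "spine_blocks T") auto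
  have "Bs = []"
  proof (rule ccontr)
    assume ne: "Bs \<noteq> []"
    then have T: "T = B \<oplus> dsum_list Bs"
      using dsum_list_spine_blocks[of T] BBs by (simp add: dsum_list_Cons)
    moreover from adm have "admissible B" "admissible (dsum_list Bs)"
      by (simp_all only: T admissible_dsum)
    ultimately show False using ind by (auto simp: indecomposable_def)
  qed
  with BBs adm dsum_list_spine_blocks[of T] show "admissible T \<and> spine_blocks T = [T]" by auto
next
  assume T: "admissible T \<and> spine_blocks T = [T]"
  have "T \<noteq> U \<oplus> V" for U V
  proof
    assume "T = U \<oplus> V"
    with T have "length (spine_blocks U @ spine_blocks V) = 1"
      by (metis One_nat_def length_Cons list.size(3) spine_blocks_dsum)
    then show False
      using spine_blocks_nonempty[of U] spine_blocks_nonempty[of V]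
      by (simp add: add_is_1 del: spine_blocks_nonempty)
  qed
  with T show "indecomposable T" by (auto simp: indecomposable_def)
qed

lemma spine_blocks_dsum_list:
  "Ts \<noteq> [] \<Longrightarrow> \<forall>B \<in> set Ts. indecomposable B \<Longrightarrow> spine_blocks (dsum_list Ts) = Ts"
  by (induction Ts rule: dsum_list.induct) (auto simp: spine_blocks_dsum indecomposable_iff)

lemma indecomposable_spine_blocks:
  "admissible T \<Longrightarrow> B \<in> set (spine_blocks T) \<Longrightarrow> indecomposable B"
  by (simp add: indecomposable_iff admissible_spine_blocks spine_blocks_singleton)

text \<open>Existence: the spine blocks are indecomposable and sum to \<open>T\<close>. Uniqueness:
  \<open>spine_blocks\<close> recovers any list of indecomposables from its sum.\<close>

lemma blocks_eq_spine_blocks: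
  assumes "admissible T"
  shows "blocks T = spine_blocks T"
  unfolding blocks_def
  using assms
  by (intro the_equality)
    (auto simp: dsum_list_spine_blocks indecomposable_spine_blocks spine_blocks_dsum_list)

lemma dsum_list_blocks: "admissible T \<Longrightarrow> dsum_list (blocks T) = T"
  by (simp add: blocks_eq_spine_blocks dsum_list_spine_blocks)

lemma blocks_dsum:
  "admissible T \<Longrightarrow> admissible S \<Longrightarrow> blocks (T \<oplus> S) = blocks T @ blocks S"
  by (simp add: blocks_eq_spine_blocks spine_blocks_dsum)

lemma bl_Leaf: "bl Leaf = 1"
  by (simp add: bl_def blocks_eq_spine_blocks)

lemma bl_Node:
  "admissible (Node L c R) \<Longrightarrow> bl (Node L c R) = (if L = Leaf \<and> c = Circ then bl R + 1 else bl R)"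
  by (simp add: bl_def blocks_eq_spine_blocks admissible_Node)

lemma bl_dsum: "admissible T \<Longrightarrow> admissible S \<Longrightarrow> bl (T \<oplus> S) = bl T + bl S"
  by (simp add: bl_def blocks_dsum)

lemma bl_pos: "admissible T \<Longrightarrow> bl T > 0"
  by (simp add: bl_def blocks_eq_spine_blocks)

text \<open>Turns the cuts in \<open>psi_step\<close> into summands. Both bounds are strict so that
  neither segment is empty, where \<open>dsum_list\<close> is unspecified.\<close>

lemma dsum_split:
  assumes T: "admissible T" and k: "0 < k" "k < bl T"
  obtains U R where "admissible U" "admissible R" "T = U \<oplus> R" "bl U = k"
proof -
  define U where "U = dsum_list (take k (blocks T))"
  define R where "R = dsum_list (drop k (blocks T))"
  have ne: "take k (blocks T) \<noteq> []" "drop k (blocks T) \<noteq> []"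
    using k by (auto simp: bl_def)
  have TUR: "T = U \<oplus> R"
    using dsum_list_append[OF ne] dsum_list_blocks[OF T] by (simp add: U_def R_def)
  then have adm: "admissible U" "admissible R" using T by auto
  have "\<forall>B \<in> set (take k (blocks T)). indecomposable B"
    using T by (auto simp: blocks_eq_spine_blocks dest: in_set_takeD indecomposable_spine_blocks)
  then have "blocks U = take k (blocks T)"
    using adm ne by (simp add: U_def blocks_eq_spine_blocks spine_blocks_dsum_list)
  then have "bl U = k" using k by (simp add: bl_def)
  with TUR adm show thesis by (rule_tac that)
qed

section \<open>Inverting the cases of \<open>\<Phi>\<close>\<close>

lemma psi_step_simple:
  "psi_step T (0, 1) = cir Leaf T" "psi_step T (1, 1) = bul Leaf T"
  by (simp_all add: psi_step_def)

lemma psi_step_bul_bul: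
  "admissible U \<Longrightarrow> admissible R \<Longrightarrow>
     psi_step (U \<oplus> R) (int (bl U) + 1, 1) = bul (bul Leaf U) R"
  using bl_pos[of U] bl_pos[of R]
  by (simp add: psi_step_def Let_def Suc_le_eq blocks_dsum bl_def dsum_list_blocks)

lemma psi_step_cir_bul:
  "admissible U \<Longrightarrow> admissible R \<Longrightarrow>
     psi_step (U \<oplus> R) (1, 1 - int (bl U)) = cir (bul Leaf U) R"
  using bl_pos[of U] bl_pos[of R]
  by (simp add: psi_step_def Let_def Suc_le_eq blocks_dsum bl_def dsum_list_blocks)

lemma psi_step_cir_bul_bul:
  assumes "admissible U1" "admissible U2" "admissible R"
  shows "psi_step (U1 \<oplus> U2 \<oplus> R) (int (bl U1) + 1, 1 - int (bl U2)) =
     cir (bul (bul Leaf U1) U2) R"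
proof -
  \<comment> \<open>This is \<open>nat (a - b)\<close>, the position where the segment of
    \<open>U2\<close> ends.\<close>
  have "nat (int (length (blocks U1)) + int (length (blocks U2))) =
      length (blocks U1) + length (blocks U2)"
    by simp
  then show ?thesis
    using assms bl_pos[of U1] bl_pos[of U2]
    by (simp add: psi_step_def Let_def Suc_le_eq blocks_dsum bl_def dsum_list_blocks)
qed

section \<open>Paths and their heights\<close>

definition path_height :: "path \<Rightarrow> int" where
  "path_height Q = sum_list (map snd Q) - sum_list (map fst Q)"

lemma path_height_simps [simp]:
  "path_height [] = 0" "path_height (Q @ [(a, b)]) = path_height Q + b - a"
  by (simp_all add: path_height_def)

lemma F_paths_0: "F_paths 0 = {[]}"
  by (auto simp: F_paths_def xpos_def ypos_def)

text \<open>The conditions on proper prefixes are those for \<open>Q\<close>; only the new endpoint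
  adds one.\<close>

lemma F_paths_snoc:
  "Q @ [s] \<in> F_paths (Suc m) \<longleftrightarrow> Q \<in> F_paths m \<and> s \<in> F_steps \<and> 0 \<le> path_height (Q @ [s])"
  by (auto simp: F_paths_def xpos_def ypos_def path_height_def le_Suc_eq all_conj_distrib)

text \<open>The height formula is proved along with membership because it gives the endpoint
  condition: \<open>bl T - 1\<close> is nonnegative. In the last three forms the new step cancels
  the blocks of the \<open>U\<close> parts, leaving \<open>bl R - 1\<close>.\<close>

lemma Phi_correct:
  "admissible T \<Longrightarrow>
     Phi T \<in> F_paths (size T) \<and> path_height (Phi T) = int (bl T) - 1 \<and> Psi (Phi T) = T"
proof (induction T rule: Phi.induct)
  case 1
  then show ?case by (simp add: F_paths_0 bl_Leaf)
next
  case (2 R)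
  then show ?case
    by (auto simp: admissible_Node F_paths_snoc F_steps_def bl_Node psi_step_simple)
next
  case (3 R)
  then show ?case
    by (auto simp: admissible_Node F_paths_snoc F_steps_def bl_Node psi_step_simple
        dest: bl_pos)
next
  case (4 U R)
  then have "admissible U" "admissible R" by (auto simp: admissible_Node)
  with 4 bl_pos[of R] show ?case
    by (auto simp: F_paths_snoc F_steps_def bl_Node bl_dsum psi_step_bul_bul)
next
  case (5 U R)
  then have "admissible U" "admissible R" by (auto simp: admissible_Node)
  with 5 bl_pos[of R] show ?case
    by (auto simp: F_paths_snoc F_steps_def bl_Node bl_dsum psi_step_cir_bul)
next
  case (6 U1 U2 R)
  then have "admissible U1" "admissible U2" "admissible R" by (auto simp: admissible_Node)
  with 6 bl_pos[of R] show ?case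
    by (auto simp: F_paths_snoc F_steps_def bl_Node bl_dsum psi_step_cir_bul_bul add.assoc)
\<comment> \<open>The remaining patterns are inadmissible; where a label \<open>c\<close> is free,
  either value creates a forbidden subtree.\<close>
qed (auto simp: admissible_Node, (metis label.exhaust)+)

text \<open>The height bound says \<open>a - b < bl T\<close>, so a block is left for
  \<open>R\<close>. Once \<open>T\<close> is written as a sum, \<open>psi_step\<close> yields the
  left side of an equation of \<open>Phi\<close>.\<close>

lemma psi_step_correct:
  assumes T: "admissible T" and s: "(a, b) \<in> F_steps" and ht: "int (bl T) - 1 + b - a \<ge> 0"
  shows "admissible (psi_step T (a, b)) \<and> size (psi_step T (a, b)) = Suc (size T) \<and>
    Phi (psi_step T (a, b)) = Phi T @ [(a, b)]"
proof -
  consider "(a, b) = (0, 1)" | "(a, b) = (1, 1)" | "a \<ge> 2" "b = 1" | "a = 1" "b \<le> 0"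
    | "a \<ge> 2" "b \<le> 0"
    using s by (fastforce simp: F_steps_def)
  then show ?thesis
  proof cases
    case 1
    with T show ?thesis by (auto simp: psi_step_simple admissible_Node)
  next
    case 2
    with T show ?thesis by (auto simp: psi_step_simple admissible_Node)
  next
    case 3
    obtain U R where UR: "admissible U" "admissible R" "T = U \<oplus> R" "bl U = nat (a - 1)"
      by (rule dsum_split[OF T, of "nat (a - 1)"]) (use 3 ht in auto)
    then have "(a, b) = (int (bl U) + 1, 1)" using 3 by simp
    with UR(1-3) show ?thesis by (auto simp: psi_step_bul_bul admissible_Node)
  next
    case 4
    obtain U R where UR: "admissible U" "admissible R" "T = U \<oplus> R" "bl U = nat (1 - b)"
      by (rule dsum_split[OF T, of "nat (1 - b)"]) (use 4 ht in auto)
    then have "(a, b) = (1, 1 - int (bl U))" using 4 by simp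
    with UR(1-3) show ?thesis by (auto simp: psi_step_cir_bul admissible_Node)
  next
    case 5
    obtain U1 V where UV: "admissible U1" "admissible V" "T = U1 \<oplus> V" "bl U1 = nat (a - 1)"
      by (rule dsum_split[OF T, of "nat (a - 1)"]) (use 5 ht in auto)
    \<comment> \<open>With the height bound this gives \<open>1 - b < bl V\<close>, as the second
      split requires.\<close>
    then have "bl T = nat (a - 1) + bl V" by (simp add: bl_dsum)
    then obtain U2 R where UR: "admissible U2" "admissible R" "V = U2 \<oplus> R" "bl U2 = nat (1 - b)"
      by (rule_tac dsum_split[OF UV(2), of "nat (1 - b)"]) (use 5 ht in auto)
    have "(a, b) = (int (bl U1) + 1, 1 - int (bl U2))" using 5 UV UR by simp
    with UV(1-3) UR(1-3) show ?thesis by (auto simp: psi_step_cir_bul_bul admissible_Node)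
  qed
qed

text \<open>For a shorter path \<open>Q\<close>, \<open>Phi (Psi Q) = Q\<close> carries the height
  formula of \<open>Phi_correct\<close> over to \<open>Q\<close>, which supplies the bound for the
  next step.\<close>

lemma Psi_correct:
  "Q \<in> F_paths m \<Longrightarrow> admissible (Psi Q) \<and> size (Psi Q) = m \<and> Phi (Psi Q) = Q"
proof (induction Q arbitrary: m rule: rev_induct)
  case Nil
  then show ?case by (simp add: F_paths_def)
next
  case (snoc s Q)
  obtain a b where s: "s = (a, b)" by fastforce
  have m: "m = Suc (length Q)" using snoc.prems by (simp add: F_paths_def)
  with snoc.prems have Q: "Q \<in> F_paths (length Q)" "s \<in> F_steps" "0 \<le> path_height (Q @ [s])"
    by (simp_all add: F_paths_snoc)
  note IH = snoc.IH[OF Q(1)]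
  then have "path_height Q = int (bl (Psi Q)) - 1" using Phi_correct[of "Psi Q"] by simp
  with psi_step_correct[of "Psi Q" a b] IH Q s m show ?case by simp
qed

theorem theorem4:
  fixes n :: nat
  assumes "n \<ge> 1"
  shows "bij_betw Phi (adm_trees n) (F_paths (n - 1))
       \<and> bij_betw Psi (F_paths (n - 1)) (adm_trees n)
       \<and> (\<forall>T \<in> adm_trees n. Psi (Phi T) = T)
       \<and> (\<forall>Q \<in> F_paths (n - 1). Phi (Psi Q) = Q)"
proof -
  have *: "Phi T \<in> F_paths (n - 1)" "Psi (Phi T) = T" if "T \<in> adm_trees n" for T
    using that Phi_correct[of T] by (auto simp: adm_trees_def size1_size)
  have **: "Psi Q \<in> adm_trees n" "Phi (Psi Q) = Q" if "Q \<in> F_paths (n - 1)" for Q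
    using that assms Psi_correct[of Q "n - 1"] by (auto simp: adm_trees_def size1_size)
  have "bij_betw Phi (adm_trees n) (F_paths (n - 1))"
    by (rule bij_betw_byWitness[where f' = Psi]) (use * ** in auto)
  moreover have "bij_betw Psi (F_paths (n - 1)) (adm_trees n)"
    by (rule bij_betw_byWitness[where f' = Phi]) (use * ** in auto)
  ultimately show ?thesis using * ** by blast
qed

end
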